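(* Consider the state space system $\frac{\mathrm{d}}{\mathrm{d}t}x=Ax+Bu$ with $A\in\mathbb{R}^{n\times n}$ and $B\in\mathbb{R}^{n\times m}$. Let $G$ be the bipartite graph associated to $M(s)=\begin{bmatrix} sI-A & B\end{bmatrix}\in\mathbb{R}^{n\times(n+m)}[s]$, and let $G_{nr}$ be obtained from $G$ by removing all redundant edges. The system $(A,B)$ is generically controllable if and only if $G_{nr}$ has the property that each state is connected to some input vertex.
   Context: $(A,B)$ is controllable iff $\begin{bmatrix}\lambda I-A & B\end{bmatrix}$ has rank $n$ for every $\lambda\in\mathbb{C}$ (equivalently $\begin{bmatrix}B & AB&\cdots&A^{n-1}B\end{bmatrix}$ has rank $n$). Associated graph: $G=(R,C;E)$ has $R$ = the $n$ rows of $M$, $C$ = the $n+m$ columns of $M$, with an edge between a row and a column exactly when the corresponding entry of $M$ is a nonzero polynomial. The first $n$ columns are the state vertices $x_1,\dots,x_n$ and the last $m$ columns are the input vertices $u_1,\dots,u_m$. A matching is a set of edges such that each vertex lies on at most one of them; it is $R$-saturating if it has $|R|$ edges. An edge of $G$ is redundant if it belongs to no $R$-saturating matching of $G$. A state $x_i$ is connected to an input vertex $u_j$ in $G_{nr}$ if they lie in the same connected component of the undirected graph $G_{nr}$. Genericity: the nonzero entries of $M(s)$ are regarded as chosen independently. That is, the zero/nonzero pattern of $M(s)$ is fixed; the diagonal entries are $s-a_{ii}$ with each $a_{ii}$ a free real parameter, and the off-diagonal entries of $A$ and the entries of $B$ in nonzero positions are free real parameters, all of these ($N$ in total) being independent.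 $(A,B)$ is generically controllable if the set of parameter values in $\mathbb{R}^N$ for which $(A,B)$ is not controllable is contained in a nontrivial algebraic variety, i.e. in the solution set of $f=0$ for some nonzero polynomial $f$ in the $N$ parameters. *)

theory Defs
  imports
    "HOL-Analysis.Analysis"
    "HOL-Computational_Algebra.Polynomial"
    "HOL-Library.Poly_Mapping"
begin

section \<open>State space systems\<close>

definition hcat :: "'a ^ 'n ^ 'r \<Rightarrow> 'a ^ 'm ^ 'r \<Rightarrow> 'a ^ ('n::finite + 'm::finite) ^ 'r" where
  "hcat X Y = (\<chi> i c. case c of Inl j \<Rightarrow> X $ i $ j | Inr k \<Rightarrow> Y $ i $ k)"

definition controllable :: "real ^ 'n ^ 'n \<Rightarrow> real ^ 'm ^ 'n \<Rightarrow> bool" where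
  "controllable A B \<longleftrightarrow>
     (\<forall>l::complex. rank (hcat (mat l - map_matrix complex_of_real A)
                              (map_matrix complex_of_real B)) = CARD('n))"

text \<open>The matrix \<open>M(s) = [sI - A, B]\<close>; the indeterminate \<open>s\<close> is \<open>[:0, 1:]\<close>.\<close>

definition sys_matrix :: "real ^ 'n ^ 'n \<Rightarrow> real ^ 'm ^ 'n \<Rightarrow> real poly ^ ('n + 'm) ^ 'n" where
  "sys_matrix A B = hcat (mat [:0, 1:] - map_matrix (\<lambda>a. [:a:]) A) (map_matrix (\<lambda>b. [:b:]) B)"


section \<open>Bipartite graphs\<close>

text \<open>
  A bipartite graph whose row vertices are all elements of \<open>'r\<close> and whose column vertices
  are all elements of \<open>'c\<close> is given by its set of edges, each edge being a (row, column) pair.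
\<close>

definition assoc_graph :: "('a::zero) ^ 'c ^ 'r \<Rightarrow> ('r \<times> 'c) set" where
  "assoc_graph M = {(i, c). M $ i $ c \<noteq> 0}"

definition matching :: "('r \<times> 'c) set \<Rightarrow> ('r \<times> 'c) set \<Rightarrow> bool" where
  "matching E F \<longleftrightarrow> F \<subseteq> E
     \<and> (\<forall>r c c'. (r, c) \<in> F \<and> (r, c') \<in> F \<longrightarrow> c = c')
     \<and> (\<forall>r r' c. (r, c) \<in> F \<and> (r', c) \<in> F \<longrightarrow> r = r')"

definition row_saturating :: "('r::finite \<times> 'c::finite) set \<Rightarrow> bool" where
  "row_saturating F \<longleftrightarrow> card F = CARD('r)"

definition redundant :: "('r::finite \<times> 'c::finite) set \<Rightarrow> 'r \<times> 'c \<Rightarrow> bool" where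
  "redundant E e \<longleftrightarrow> e \<in> E \<and> \<not> (\<exists>F. matching E F \<and> row_saturating F \<and> e \<in> F)"

definition nonredundant_part :: "('r::finite \<times> 'c::finite) set \<Rightarrow> ('r \<times> 'c) set" where
  "nonredundant_part E = {e \<in> E. \<not> redundant E e}"

text \<open>Vertices of the undirected graph: \<open>Inl r\<close> for a row \<open>r\<close>, \<open>Inr c\<close> for a column \<open>c\<close>.\<close>

definition adjacency :: "('r \<times> 'c) set \<Rightarrow> (('r + 'c) \<times> ('r + 'c)) set" where
  "adjacency E = {(Inl r, Inr c) |r c. (r, c) \<in> E} \<union> {(Inr c, Inl r) |r c. (r, c) \<in> E}"

definition same_component :: "('r \<times> 'c) set \<Rightarrow> 'r + 'c \<Rightarrow> 'r + 'c \<Rightarrow> bool" where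
  "same_component E v w \<longleftrightarrow> (v, w) \<in> (adjacency E)\<^sup>*"

text \<open>In the graph of a system matrix the columns \<open>Inl i\<close> are the states, \<open>Inr j\<close> the inputs.\<close>

abbreviation state_vertex :: "'n \<Rightarrow> 'n + ('n + 'm)" where
  "state_vertex i \<equiv> Inr (Inl i)"

abbreviation input_vertex :: "'m \<Rightarrow> 'n + ('n + 'm)" where
  "input_vertex j \<equiv> Inr (Inr j)"


section \<open>Generic controllability\<close>

text \<open>
  A real polynomial in variables of type \<open>'v\<close> is a finitely supported map from monomials
  (finitely supported maps from variables to exponents) to coefficients.
\<close>

type_synonym 'v multipoly = "('v \<Rightarrow>\<^sub>0 nat) \<Rightarrow>\<^sub>0 real"

definition multipoly_vars :: "'v multipoly \<Rightarrow> 'v set" where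
  "multipoly_vars f = (\<Union>t\<in>Poly_Mapping.keys f. Poly_Mapping.keys t)"

definition multipoly_eval :: "'v multipoly \<Rightarrow> ('v \<Rightarrow> real) \<Rightarrow> real" where
  "multipoly_eval f p = (\<Sum>t\<in>Poly_Mapping.keys f. Poly_Mapping.lookup f t * (\<Prod>v\<in>Poly_Mapping.keys t. p v ^ Poly_Mapping.lookup t v))"

text \<open>
  There is one real parameter for each nonzero position of \<open>M(s)\<close>, so the parameter space
  \<open>\<real>\<^sup>N\<close> is \<open>E \<rightarrow>\<^sub>E UNIV\<close> with \<open>E\<close> the edge set of the graph of \<open>M(s)\<close>. Since the
  diagonal entries of \<open>sI - A\<close> are nonzero polynomials, every diagonal position of \<open>A\<close> carries a
  parameter, even when the given \<open>A\<close> has a zero there.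
\<close>

definition param_A :: "('n \<times> ('n + 'm)) set \<Rightarrow> ('n \<times> ('n + 'm) \<Rightarrow> real) \<Rightarrow> real ^ 'n ^ 'n" where
  "param_A E p = (\<chi> i j. if (i, Inl j) \<in> E then p (i, Inl j) else 0)"

definition param_B :: "('n \<times> ('n + 'm)) set \<Rightarrow> ('n \<times> ('n + 'm) \<Rightarrow> real) \<Rightarrow> real ^ 'm ^ 'n" where
  "param_B E p = (\<chi> i k. if (i, Inr k) \<in> E then p (i, Inr k) else 0)"

text \<open>
  The variables of \<open>f\<close> have to be restricted to \<open>E\<close>: otherwise the indeterminate of an
  absent position would not be one of the \<open>N\<close> parameters.
\<close>

definition generically_controllable :: "real ^ 'n ^ 'n \<Rightarrow> real ^ 'm ^ 'n \<Rightarrow> bool" where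
  "generically_controllable A B \<longleftrightarrow>
     (let E = assoc_graph (sys_matrix A B) in
      \<exists>f :: ('n \<times> ('n + 'm)) multipoly. f \<noteq> 0 \<and> multipoly_vars f \<subseteq> E \<and>
        {p \<in> E \<rightarrow>\<^sub>E UNIV. \<not> controllable (param_A E p) (param_B E p)}
          \<subseteq> {p \<in> E \<rightarrow>\<^sub>E UNIV. multipoly_eval f p = 0})"

end

theory Submission
  imports Defs "HOL-Computational_Algebra.Fundamental_Theorem_Algebra"
begin

text \<open>
  All diagonal positions carry parameters, so both sides amount to every state being reachable from
  an input along directed edges. Inaccessible states give a block of rows of \<open>[\<lambda>I - A, B]\<close> that is
  square up to zeros, hence an uncontrollable eigenvalue for every choice of parameters; and since
  these rows have exactly as many neighbouring columns, each saturating matching uses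
  up these columns, so no edge of the nonredundant graph leaves the block. If all states are
  accessible, choose a spanning forest directed away from the inputs. With distinct diagonal
  entries, ones on the forest and zeros elsewhere the system is controllable, so \<open>n\<close> of the vectors
  \<open>A\<^sup>k b\<^sub>j\<close> are independent there, and their determinant is the polynomial sought. Every forest edge
  lies on the matching that follows the forest above it and is diagonal elsewhere.
\<close>

section \<open>Linear algebra\<close>

lemma vector_matrix_mult_sum_rows:
  fixes v :: "'a::comm_semiring_1 ^ 'r" and H :: "'a ^ 'c ^ 'r"
  shows "v v* H = (\<Sum>i\<in>UNIV. v $ i *s row i H)"
  by (simp add: vec_eq_iff vector_matrix_mult_def row_def)

text \<open>Independence speaks of the set \<open>rows H\<close>, in which equal rows collapse. Each
  direction therefore first shows that the row indexing is injective: by counting in one, by testing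
  the vector \<open>axis i 1 - axis j 1\<close> in the other.\<close>

lemma rank_eq_card_rows_iff:
  fixes H :: "'a::field ^ 'c ^ 'r"
  shows "rank H = CARD('r) \<longleftrightarrow> (\<forall>v. v v* H = 0 \<longrightarrow> v = 0)"
proof -
  have rows: "rows H = range (\<lambda>i. row i H)" by (auto simp: rows_def)
  have fin: "finite (rows H)" by (simp add: rows)
  have le: "vec.dim (rows H) \<le> card (rows H)" by (rule vec.dim_le_card'[OF fin])
  have le': "card (rows H) \<le> CARD('r)" unfolding rows by (rule card_image_le) simp
  show ?thesis
  proof
    assume r: "rank H = CARD('r)"
    then have eq: "vec.dim (rows H) = CARD('r)" by (simp add: row_rank_def_gen)
    with le le' have c: "card (rows H) = CARD('r)" by simp
    have inj: "inj (\<lambda>i. row i H)"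
      using c unfolding rows by (simp add: eq_card_imp_inj_on)
    have ind: "vec.independent (rows H)"
      using c eq fin by (metis vec.basis_exists card_subset_eq)
    show "\<forall>v. v v* H = 0 \<longrightarrow> v = 0"
    proof (intro allI impI)
      fix v assume "v v* H = 0"
      then have "(\<Sum>i\<in>UNIV. v $ i *s row i H) = 0" by (simp add: vector_matrix_mult_sum_rows)
      then have "(\<Sum>x\<in>rows H. v $ (inv (\<lambda>i. row i H) x) *s x) = 0"
        unfolding rows by (simp add: sum.reindex[OF inj] inv_f_f[OF inj])
      then have "v $ (inv (\<lambda>i. row i H) x) = 0" if "x \<in> rows H" for x
        using vec.independentD[OF ind fin subset_refl,
            where u = "\<lambda>x. v $ inv (\<lambda>i. row i H) x"] that by blast
      then have "v $ i = 0" for i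
        using inv_f_f[OF inj] unfolding rows by (metis rangeI)
      then show "v = 0" by (simp add: vec_eq_iff)
    qed
  next
    assume *: "\<forall>v. v v* H = 0 \<longrightarrow> v = 0"
    have inj: "inj (\<lambda>i. row i H)"
    proof (rule injI, rule ccontr)
      fix i j assume e: "row i H = row j H" and ne: "i \<noteq> j"
      have "(axis i 1 - axis j 1) v* H = 0"
        using e by (simp add: vec_eq_iff vector_matrix_mult_def row_def axis_def
            left_diff_distrib sum_subtractf if_distrib[of "\<lambda>x. x * _"] cong: if_cong)
      with * have "axis i 1 - axis j 1 = (0::'a^'r)" by blast
      then have "(axis i 1 - axis j 1 :: 'a^'r) $ i = 0" by simp
      with ne show False by (simp add: axis_def)
    qed
    have "vec.independent (rows H)"
    proof (rule vec.independent_if_scalars_zero[OF fin])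
      fix f x assume s: "(\<Sum>x\<in>rows H. f x *s x) = 0" and x: "x \<in> rows H"
      from s have "(\<chi> i. f (row i H)) v* H = 0"
        unfolding rows by (simp add: sum.reindex[OF inj] vector_matrix_mult_sum_rows)
      with * have "(\<chi> i. f (row i H)) = 0" by blast
      with x show "f x = 0" by (auto simp: rows vec_eq_iff)
    qed
    then have "vec.dim (rows H) = card (rows H)" by (rule vec.dim_eq_card_independent)
    also have "\<dots> = CARD('r)" unfolding rows by (rule card_image[OF inj])
    finally show "rank H = CARD('r)" by (simp add: row_rank_def_gen)
  qed
qed

text \<open>Among the nonzero polynomials \<open>p\<close> with \<open>v0\<close>
  p(\<open>M\<close>) = 0 take one of least degree and split off a root \<open>z\<close>, so that p
  = (X - z) q. By minimality \<open>v0\<close> q(\<open>M\<close>) is nonzero, and it is an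
  eigenvector for \<open>z\<close>.\<close>

lemma invariant_subspace_eigenvector:
  fixes M :: "complex ^ 'n ^ 'n"
  assumes V: "vec.subspace V" and v0: "v0 \<in> V" "v0 \<noteq> 0"
    and inv: "\<And>v. v \<in> V \<Longrightarrow> v v* M \<in> V"
  obtains l v where "v \<in> V" "v \<noteq> 0" "v v* M = l *s v"
proof -
  define w where "w k = ((\<lambda>v. v v* M) ^^ k) v0" for k
  have w0: "w 0 = v0" and wS: "w (Suc k) = w k v* M" for k by (simp_all add: w_def)
  have wV: "w k \<in> V" for k by (induction k) (auto simp: w0 wS v0 inv)
  \<comment> \<open>\<open>w k\<close> is \<open>v0\<close> times the \<open>k\<close>-th power of
    \<open>M\<close>, so \<open>\<Phi> p\<close> is \<open>v0\<close> times
    p(\<open>M\<close>).\<close>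
  define \<Phi> where "\<Phi> p = (\<Sum>k\<le>degree p. coeff p k *s w k)" for p
  have \<Phi>_eq: "\<Phi> p = (\<Sum>k\<le>N. coeff p k *s w k)" if "degree p \<le> N" for p N
    unfolding \<Phi>_def
    by (rule sum.mono_neutral_left) (use that in \<open>auto simp: coeff_eq_0\<close>)
  have "\<exists>p. p \<noteq> 0 \<and> \<Phi> p = 0"
  \<comment> \<open>Dependence is again about sets: a repetition among the iterates gives an
    annihilating difference of two monomials, otherwise n + 1 distinct vectors are
    dependent.\<close>
  proof (cases "inj_on w {..CARD('n)}")
    case False
    then obtain i j where ij: "i \<noteq> j" "w i = w j" by (auto simp: inj_on_def)
    define p where "p = monom (1::complex) i - monom 1 j"
    have "coeff p i \<noteq> 0" using ij by (simp add: p_def)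
    moreover have "\<Phi> p = 0"
    proof -
      have d: "degree p \<le> max i j" unfolding p_def
        by (rule degree_diff_le) (auto intro: order_trans[OF degree_monom_le])
      have "\<Phi> p = (\<Sum>k\<le>max i j. (if i = k then w k else 0) - (if j = k then w k else 0))"
        unfolding \<Phi>_eq[OF d] by (intro sum.cong) (auto simp: p_def)
      then show ?thesis using ij by (simp add: sum_subtractf)
    qed
    ultimately show ?thesis by (intro exI[of _ p]) auto
  next
    case inj: True
    have fin: "finite (w ` {..CARD('n)})" by simp
    have "card (w ` {..CARD('n)}) > vec.dim (w ` {..CARD('n)})"
      using inj dim_subset_UNIV_cart_gen[of "w ` {..CARD('n)}"] by (simp add: card_image less_Suc_eq_le)
    then have "vec.dependent (w ` {..CARD('n)})"
      using vec.dim_eq_card_independent by fastforce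
    then obtain u where u: "\<exists>x\<in>w ` {..CARD('n)}. u x \<noteq> 0"
        "(\<Sum>x\<in>w ` {..CARD('n)}. u x *s x) = 0"
      using vec.dependent_finite[OF fin] by blast
    define p where "p = (\<Sum>k\<le>CARD('n). monom (u (w k)) k)"
    have c: "coeff p k = (if k \<le> CARD('n) then u (w k) else 0)" for k
      by (auto simp: p_def coeff_sum if_distrib cong: if_cong)
    have d: "degree p \<le> CARD('n)" by (rule degree_le) (auto simp: c)
    have "\<Phi> p = 0" unfolding \<Phi>_eq[OF d] using u(2) by (simp add: c sum.reindex[OF inj])
    moreover have "p \<noteq> 0"
    proof -
      from u(1) obtain k where "k \<le> CARD('n)" "u (w k) \<noteq> 0" by auto
      then have "coeff p k \<noteq> 0" by (simp add: c)
      then show ?thesis by auto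
    qed
    ultimately show ?thesis by blast
  qed
  then obtain p where p: "p \<noteq> 0" "\<Phi> p = 0"
    and min: "\<And>q. q \<noteq> 0 \<Longrightarrow> degree q < degree p \<Longrightarrow> \<Phi> q \<noteq> 0"
    using ex_has_least_nat[of "\<lambda>p. p \<noteq> 0 \<and> \<Phi> p = 0" _ degree] by (metis not_less)
  have "degree p \<noteq> 0"
  proof
    assume "degree p = 0"
    with p v0 show False by (simp add: \<Phi>_def w0) (metis leading_coeff_0_iff)
  qed
  then have "\<not> constant (poly p)" by (simp add: constant_degree)
  then obtain z where "poly p z = 0" using fundamental_theorem_of_algebra by blast
  then obtain q where q: "p = [:-z, 1:] * q" by (metis poly_eq_0_iff_dvd dvdE)
  with p have q0: "q \<noteq> 0" by auto
  then have dp: "degree p = Suc (degree q)" unfolding q by (subst degree_mult_eq) auto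
  have coeff_p: "coeff p k = coeff (pCons 0 q) k - z * coeff q k" for k
    unfolding q by simp
  have lin: "\<Phi> q v* M = (\<Sum>k\<le>degree q. coeff q k *s w (Suc k))"
  proof -
    have "(\<Sum>k\<in>K. coeff q k *s w k) v* M = (\<Sum>k\<in>K. coeff q k *s w (Suc k))" if "finite K" for K
      using that by (induction K) (simp_all add: vector_matrix_left_distrib wS scalar_vector_matrix_assoc)
    then show ?thesis by (simp add: \<Phi>_def)
  qed
  \<comment> \<open>Under \<open>\<Phi>\<close>, the shift of coefficients by \<open>pCons 0\<close>
    becomes an application of \<open>M\<close>.\<close>
  have "\<Phi> p = (\<Sum>k\<le>Suc (degree q). coeff (pCons 0 q) k *s w k) - z *s (\<Sum>k\<le>Suc (degree q). coeff q k *s w k)"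
    unfolding \<Phi>_def dp coeff_p
    by (simp only: vec.scale_left_diff_distrib sum_subtractf vec.scale_sum_right vec.scale_scale)
  also have "(\<Sum>k\<le>Suc (degree q). coeff (pCons 0 q) k *s w k) = \<Phi> q v* M"
    unfolding lin by (subst sum.atMost_Suc_shift) simp
  also have "(\<Sum>k\<le>Suc (degree q). coeff q k *s w k) = \<Phi> q" by (rule \<Phi>_eq[symmetric]) simp
  finally have "\<Phi> q v* M = z *s \<Phi> q" using p by simp
  moreover have "\<Phi> q \<noteq> 0" using min q0 dp by simp
  moreover have "\<Phi> q \<in> V" unfolding \<Phi>_def
    by (intro vec.subspace_sum vec.subspace_scale V wV)
  ultimately show ?thesis using that by blast
qed

section \<open>The Hautus test and Krylov vectors\<close>

text \<open>Full row rank means a trivial left kernel, and the left kernel of a block row is the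
  intersection of those of its blocks.\<close>

lemma controllable_iff_left_eigenvector:
  fixes A :: "real ^ 'n ^ 'n" and B :: "real ^ 'm ^ 'n"
  shows "controllable A B \<longleftrightarrow>
    (\<forall>l v. v v* map_matrix complex_of_real A = l *s v \<longrightarrow>
           v v* map_matrix complex_of_real B = 0 \<longrightarrow> v = 0)"
proof -
  have "v v* hcat (mat l - map_matrix complex_of_real A) (map_matrix complex_of_real B) = 0 \<longleftrightarrow>
      v v* map_matrix complex_of_real A = l *s v \<and> v v* map_matrix complex_of_real B = 0"
    for l and v :: "complex ^ 'n"
  proof -
    have "v v* hcat (mat l - map_matrix complex_of_real A) (map_matrix complex_of_real B) = 0 \<longleftrightarrow>
        v v* (mat l - map_matrix complex_of_real A) = 0 \<and> v v* map_matrix complex_of_real B = 0"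
      by (simp add: vec_eq_iff split_sum_all vector_matrix_mult_def hcat_def)
    also have "v v* (mat l - map_matrix complex_of_real A) = l *s v - v v* map_matrix complex_of_real A"
      by (simp add: vec_eq_iff vector_matrix_mult_def mat_def right_diff_distrib sum_subtractf
          if_distrib[of "\<lambda>x. _ * x"] mult.commute cong: if_cong)
    finally show ?thesis by auto
  qed
  then show ?thesis unfolding controllable_def rank_eq_card_rows_iff by blast
qed

text \<open>The columns of the Kalman controllability matrix, continued to all exponents
  \<open>k\<close>.\<close>

definition krylov :: "real ^ 'n ^ 'n \<Rightarrow> real ^ 'm ^ 'n \<Rightarrow> nat \<Rightarrow> 'm \<Rightarrow> real ^ 'n" where
  "krylov A B k j = ((*v) A ^^ k) (column j B)"

lemma krylov_0: "krylov A B 0 j $ i = B $ i $ j"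
  by (simp add: krylov_def column_def)

lemma krylov_Suc: "krylov A B (Suc k) j = A *v krylov A B k j"
  by (simp add: krylov_def)

text \<open>The pairing is mixed because Krylov vectors are real while left eigenvectors may be
  complex.\<close>

lemma sum_mult_matrix_vector:
  fixes A :: "real ^ 'n ^ 'n" and v :: "complex ^ 'n"
  shows "(\<Sum>i\<in>UNIV. v $ i * of_real ((A *v x) $ i))
     = (\<Sum>i\<in>UNIV. (v v* map_matrix complex_of_real A) $ i * of_real (x $ i))"
proof -
  have "(\<Sum>i\<in>UNIV. v $ i * of_real ((A *v x) $ i))
      = (\<Sum>i\<in>UNIV. \<Sum>j\<in>UNIV. v $ i * of_real (A $ i $ j) * of_real (x $ j))"
    by (simp add: matrix_vector_mult_def sum_distrib_left mult.assoc)
  also have "\<dots> = (\<Sum>j\<in>UNIV. \<Sum>i\<in>UNIV. v $ i * of_real (A $ i $ j) * of_real (x $ j))"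
    by (rule sum.swap)
  also have "\<dots> = (\<Sum>i\<in>UNIV. (v v* map_matrix complex_of_real A) $ i * of_real (x $ i))"
    by (simp add: vector_matrix_mult_def sum_distrib_right map_matrix_def)
  finally show ?thesis .
qed

lemma left_eigenvector_annihilates_krylov:
  fixes v :: "complex ^ 'n"
  assumes "v v* map_matrix complex_of_real A = l *s v" "v v* map_matrix complex_of_real B = 0"
  shows "(\<Sum>i\<in>UNIV. v $ i * of_real (krylov A B k j $ i)) = 0"
proof (induction k)
  case 0
  show ?case using assms(2)
    by (simp add: krylov_0 vec_eq_iff vector_matrix_mult_def map_matrix_def)
next
  case (Suc k)
  then show ?case
    by (simp add: krylov_Suc sum_mult_matrix_vector assms(1) mult.assoc flip: sum_distrib_left)
qed

text \<open>A left eigenvector that annihilates \<open>B\<close> annihilates all Krylov vectors, so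
  no choice of exponents and inputs yields a basis.\<close>

lemma krylov_det_eq_0:
  fixes A :: "real ^ 'n ^ 'n" and B :: "real ^ 'm ^ 'n" and k :: "'n \<Rightarrow> nat" and j :: "'n \<Rightarrow> 'm"
  assumes "\<not> controllable A B"
  shows "det (\<chi> r. krylov A B (k r) (j r)) = 0"
proof (rule ccontr)
  let ?K = "\<chi> r. krylov A B (k r) (j r)"
  assume "det ?K \<noteq> 0"
  then obtain L where L: "L ** ?K = mat 1"
    by (metis invertible_det_nz invertible_left_inverse)
  from assms obtain l v where v: "v v* map_matrix complex_of_real A = l *s v"
      "v v* map_matrix complex_of_real B = 0" "v \<noteq> 0"
    by (auto simp: controllable_iff_left_eigenvector)
  \<comment> \<open>Inserting \<open>L ** ?K = mat 1\<close> writes each coordinate of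
    \<open>v\<close> as a combination of pairings of \<open>v\<close> with Krylov vectors.\<close>
  have "v $ s = 0" for s
  proof -
    have "v $ s = (\<Sum>i\<in>UNIV. of_real ((mat 1 :: real^'n^'n) $ s $ i) * v $ i)"
      by (simp add: mat_def if_distrib[of "\<lambda>x. x * _"] if_distrib[of of_real] cong: if_cong)
    also have "\<dots> = (\<Sum>i\<in>UNIV. \<Sum>r\<in>UNIV. of_real (L $ s $ r) * (v $ i * of_real (?K $ r $ i)))"
      unfolding L[symmetric]
      by (simp add: matrix_matrix_mult_def sum_distrib_right sum_distrib_left mult_ac)
    also have "\<dots> = (\<Sum>r\<in>UNIV. of_real (L $ s $ r) * (\<Sum>i\<in>UNIV. v $ i * of_real (krylov A B (k r) (j r) $ i)))"
      by (subst sum.swap) (simp add: sum_distrib_left)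
    also have "\<dots> = 0" by (simp add: left_eigenvector_annihilates_krylov[OF v(1,2)])
    finally show ?thesis .
  qed
  then show False using v(3) by (simp add: vec_eq_iff)
qed

text \<open>If the span were proper, the row vectors annihilating it would form a nonzero
  \<open>A\<close>-invariant space. A left eigenvector in it also annihilates \<open>B\<close>, by
  the case \<open>k = 0\<close>.\<close>

lemma controllable_imp_span_krylov:
  fixes A :: "real ^ 'n ^ 'n" and B :: "real ^ 'm ^ 'n"
  assumes "controllable A B"
  shows "span {krylov A B k j | k j. True} = UNIV"
proof (rule ccontr)
  let ?K = "{krylov A B k j | k j. True}"
  assume "span ?K \<noteq> UNIV"
  then have "span ?K \<subset> span (UNIV :: (real ^ 'n) set)" by auto
  then obtain w where w: "w \<noteq> 0" and orth: "\<And>x. x \<in> span ?K \<Longrightarrow> orthogonal w x"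
    using orthogonal_to_subspace_exists_gen[of ?K UNIV] by blast
  \<comment> \<open>The annihilator is taken over the complex numbers, where the real
    \<open>w\<close> survives and eigenvectors exist.\<close>
  define V where "V = {v :: complex ^ 'n. \<forall>k j. (\<Sum>i\<in>UNIV. v $ i * of_real (krylov A B k j $ i)) = 0}"
  have sub: "vec.subspace V"
    unfolding V_def vec.subspace_def
    by (simp add: distrib_right sum.distrib mult.assoc flip: sum_distrib_left)
  have wV: "(\<chi> i. complex_of_real (w $ i)) \<in> V"
  proof -
    have "(\<Sum>i\<in>UNIV. w $ i * krylov A B k j $ i) = 0" for k j
      using orth[OF span_base, of "krylov A B k j"] by (auto simp: orthogonal_def inner_vec_def)
    then show ?thesis by (simp add: V_def flip: of_real_mult of_real_sum)
  qed
  have w0: "(\<chi> i. complex_of_real (w $ i)) \<noteq> 0" using w by (simp add: vec_eq_iff)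
  have inv: "v v* map_matrix complex_of_real A \<in> V" if "v \<in> V" for v
    using that by (simp add: V_def flip: sum_mult_matrix_vector krylov_Suc)
  obtain l v where v: "v \<in> V" "v \<noteq> 0" "v v* map_matrix complex_of_real A = l *s v"
    using invariant_subspace_eigenvector[OF sub wV w0 inv] by blast
  have "v v* map_matrix complex_of_real B = 0"
    unfolding vec_eq_iff
  proof
    fix j
    have "(\<Sum>i\<in>UNIV. v $ i * of_real (krylov A B 0 j $ i)) = 0" using v(1) by (simp add: V_def)
    then show "(v v* map_matrix complex_of_real B) $ j = 0 $ j"
      by (simp add: krylov_0 vector_matrix_mult_def map_matrix_def)
  qed
  with v assms show False by (auto simp: controllable_iff_left_eigenvector)
qed

lemma controllable_imp_krylov_det_neq_0:
  fixes A :: "real ^ 'n ^ 'n" and B :: "real ^ 'm ^ 'n"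
  assumes "controllable A B"
  obtains k j where "det (\<chi> r. krylov A B (k r) (j r)) \<noteq> 0"
proof -
  obtain S where S: "S \<subseteq> {krylov A B k j | k j. True}" "independent S"
    and sub: "{krylov A B k j | k j. True} \<subseteq> span S"
    using maximal_independent_subset by blast
  from span_minimal[OF sub subspace_span] have span: "span S = UNIV"
    unfolding controllable_imp_span_krylov[OF assms] by blast
  have "card S = CARD('n)" using dim_eq_card_independent[OF S(2)] dim_span[of S] by (simp add: span)
  moreover have "finite S" using S(2) by (rule independent_imp_finite)
  ultimately obtain b where b: "bij_betw b (UNIV :: 'n set) S"
    by (metis finite_class.finite_UNIV finite_same_card_bij)
  then have "\<forall>r. \<exists>k j. b r = krylov A B k j" using S(1) by (force simp: bij_betw_def)
  then obtain k j where kj: "\<And>r. b r = krylov A B (k r) (j r)" by metis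
  have "rows (\<chi> r. krylov A B (k r) (j r)) = S"
    using b by (auto simp: rows_def row_def bij_betw_def kj vec_lambda_eta)
  then have "det (\<chi> r. krylov A B (k r) (j r)) \<noteq> 0"
    using span by (metis invertible_det_nz invertible_left_inverse matrix_left_invertible_span_rows)
  then show ?thesis by (rule that)
qed

section \<open>Polynomial functions\<close>

definition monomial_fun :: "('v \<Rightarrow>\<^sub>0 nat) \<Rightarrow> ('v \<Rightarrow> real) \<Rightarrow> real" where
  "monomial_fun t p = (\<Prod>v\<in>Poly_Mapping.keys t. p v ^ Poly_Mapping.lookup t v)"

text \<open>A common superset of the supports allows \<open>t\<close>, \<open>u\<close> and
  \<open>t + u\<close> to be compared factor by factor.\<close>

lemma monomial_fun_superset:
  assumes "finite K" "Poly_Mapping.keys t \<subseteq> K"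
  shows "monomial_fun t p = (\<Prod>v\<in>K. p v ^ Poly_Mapping.lookup t v)"
  unfolding monomial_fun_def
  by (rule prod.mono_neutral_left) (use assms in \<open>auto simp: in_keys_iff\<close>)

lemma monomial_fun_add: "monomial_fun (t + u) p = monomial_fun t p * monomial_fun u p"
proof -
  let ?K = "Poly_Mapping.keys t \<union> Poly_Mapping.keys u"
  have "Poly_Mapping.keys (t + u) \<subseteq> ?K" by (rule Poly_Mapping.keys_add)
  then show ?thesis
    by (simp add: monomial_fun_superset[of ?K] lookup_add power_add prod.distrib)
qed

lemma multipoly_eval_superset:
  assumes "finite T" "Poly_Mapping.keys f \<subseteq> T"
  shows "multipoly_eval f p = (\<Sum>t\<in>T. Poly_Mapping.lookup f t * monomial_fun t p)"
  unfolding multipoly_eval_def monomial_fun_def[symmetric]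
  by (rule sum.mono_neutral_left) (use assms in \<open>auto simp: in_keys_iff\<close>)

lemma multipoly_eval_add: "multipoly_eval (f + g) p = multipoly_eval f p + multipoly_eval g p"
proof -
  let ?T = "Poly_Mapping.keys f \<union> Poly_Mapping.keys g"
  have "Poly_Mapping.keys (f + g) \<subseteq> ?T" by (rule Poly_Mapping.keys_add)
  then show ?thesis
    by (simp add: multipoly_eval_superset[of ?T] lookup_add distrib_right sum.distrib)
qed

text \<open>Closure of this class under sums and products shows that a Krylov determinant is a
  polynomial in the parameters without writing that polynomial down.\<close>

definition polynomial_fun :: "'v set \<Rightarrow> (('v \<Rightarrow> real) \<Rightarrow> real) \<Rightarrow> bool" where
  "polynomial_fun E g \<longleftrightarrow> (\<exists>f. multipoly_vars f \<subseteq> E \<and> (\<forall>p. multipoly_eval f p = g p))"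

lemma polynomial_fun_monomial:
  assumes "Poly_Mapping.keys t \<subseteq> E"
  shows "polynomial_fun E (\<lambda>p. c * monomial_fun t p)"
  unfolding polynomial_fun_def
proof (intro exI conjI allI)
  show "multipoly_vars (Poly_Mapping.single t c) \<subseteq> E"
    using assms by (auto simp: multipoly_vars_def split: if_splits)
  show "multipoly_eval (Poly_Mapping.single t c) p = c * monomial_fun t p" for p
    by (simp add: multipoly_eval_superset[of "{t}"])
qed

lemma polynomial_fun_const: "polynomial_fun E (\<lambda>p. c)"
  using polynomial_fun_monomial[of 0 E c] by (simp add: monomial_fun_def)

lemma polynomial_fun_var: "v \<in> E \<Longrightarrow> polynomial_fun E (\<lambda>p. p v)"
  using polynomial_fun_monomial[of "Poly_Mapping.single v 1" E 1] by (simp add: monomial_fun_def)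

lemma polynomial_fun_add:
  assumes "polynomial_fun E g" "polynomial_fun E h"
  shows "polynomial_fun E (\<lambda>p. g p + h p)"
proof -
  obtain f f' where "multipoly_vars f \<subseteq> E" "\<And>p. multipoly_eval f p = g p"
      "multipoly_vars f' \<subseteq> E" "\<And>p. multipoly_eval f' p = h p"
    using assms by (auto simp: polynomial_fun_def)
  moreover have "multipoly_vars (f + f') \<subseteq> multipoly_vars f \<union> multipoly_vars f'"
    using Poly_Mapping.keys_add[of f f'] by (auto simp: multipoly_vars_def)
  ultimately show ?thesis
    unfolding polynomial_fun_def by (intro exI[of _ "f + f'"]) (auto simp: multipoly_eval_add)
qed

lemma polynomial_fun_sum:
  assumes "\<And>i. i \<in> I \<Longrightarrow> polynomial_fun E (g i)"
  shows "polynomial_fun E (\<lambda>p. \<Sum>i\<in>I. g i p)"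
  using assms by (induction I rule: infinite_finite_induct)
    (simp_all add: polynomial_fun_const polynomial_fun_add)

lemma polynomial_fun_mult:
  assumes "polynomial_fun E g" "polynomial_fun E h"
  shows "polynomial_fun E (\<lambda>p. g p * h p)"
proof -
  obtain f f' where f: "multipoly_vars f \<subseteq> E" "\<And>p. multipoly_eval f p = g p"
    and f': "multipoly_vars f' \<subseteq> E" "\<And>p. multipoly_eval f' p = h p"
    using assms by (auto simp: polynomial_fun_def)
  have "g p * h p = (\<Sum>t\<in>Poly_Mapping.keys f. \<Sum>u\<in>Poly_Mapping.keys f'.
      (Poly_Mapping.lookup f t * Poly_Mapping.lookup f' u) * monomial_fun (t + u) p)" for p
    unfolding f(2)[symmetric] f'(2)[symmetric] multipoly_eval_superset[OF finite_keys subset_refl]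
    unfolding sum_product by (intro sum.cong refl) (simp add: monomial_fun_add)
  moreover have "Poly_Mapping.keys (t + u) \<subseteq> E"
    if "t \<in> Poly_Mapping.keys f" "u \<in> Poly_Mapping.keys f'" for t u
    using that f(1) f'(1) Poly_Mapping.keys_add[of t u] unfolding multipoly_vars_def by blast
  ultimately show ?thesis
    by (simp only:) (intro polynomial_fun_sum polynomial_fun_monomial)
qed

lemma polynomial_fun_prod:
  assumes "\<And>i. i \<in> I \<Longrightarrow> polynomial_fun E (g i)"
  shows "polynomial_fun E (\<lambda>p. \<Prod>i\<in>I. g i p)"
  using assms by (induction I rule: infinite_finite_induct)
    (simp_all add: polynomial_fun_const polynomial_fun_mult)

lemma polynomial_fun_det:
  fixes M :: "('v \<Rightarrow> real) \<Rightarrow> real ^ 'n ^ 'n"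
  assumes "\<And>i j. polynomial_fun E (\<lambda>p. M p $ i $ j)"
  shows "polynomial_fun E (\<lambda>p. det (M p))"
  unfolding det_def
  by (intro polynomial_fun_sum polynomial_fun_mult polynomial_fun_prod polynomial_fun_const assms)

text \<open>Induction on the variables: with the others fixed, the sum is a univariate polynomial in
  \<open>w\<close> with infinitely many zeros. Exponents are plain functions, only required to be
  distinct on \<open>E\<close>, so that \<open>E\<close> can shrink.\<close>

lemma monomial_sum_zero_imp_coeffs_zero:
  fixes c :: "('v \<Rightarrow> nat) \<Rightarrow> real"
  assumes "finite E" "finite T" "inj_on (\<lambda>t. restrict t E) T"
    and "\<And>p. (\<Sum>t\<in>T. c t * (\<Prod>v\<in>E. p v ^ t v)) = 0" and "t \<in> T"
  shows "c t = 0"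
  using assms
proof (induction E arbitrary: T t rule: finite_induct)
  case empty
  have "s = t" if "s \<in> T" for s
    using inj_onD[OF empty.prems(2) _ that empty.prems(4)] by (auto simp: restrict_def)
  then have "T = {t}" using empty.prems(4) by blast
  then show ?case using empty.prems(3) by simp
next
  case (insert w E)
  \<comment> \<open>These exponents contribute to the coefficient of degree \<open>t w\<close> in
    the variable \<open>w\<close>.\<close>
  define T' where "T' = {s \<in> T. s w = t w}"
  have "inj_on (\<lambda>s. restrict s E) T'"
  proof (rule inj_onI)
    fix s u assume su: "s \<in> T'" "u \<in> T'" "restrict s E = restrict u E"
    have "s v = u v" if "v \<in> insert w E" for v
      using that su(1,2) fun_cong[OF su(3), of v] by (cases "v = w") (simp_all add: T'_def)
    then have "restrict s (insert w E) = restrict u (insert w E)" by (rule restrict_ext)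
    with su(1,2) show "s = u" using inj_onD[OF insert.prems(2), of s u] by (simp add: T'_def)
  qed
  moreover have "(\<Sum>s\<in>T'. c s * (\<Prod>v\<in>E. p v ^ s v)) = 0" for p
  proof -
    define P where "P = (\<Sum>s\<in>T. monom (c s * (\<Prod>v\<in>E. p v ^ s v)) (s w))"
    have "poly P x = 0" for x
    proof -
      have "(\<Prod>v\<in>E. (p(w := x)) v ^ s v) = (\<Prod>v\<in>E. p v ^ s v)" for s
        using insert.hyps by (intro prod.cong) auto
      then have "poly P x = (\<Sum>s\<in>T. c s * (\<Prod>v\<in>insert w E. (p(w := x)) v ^ s v))"
        using insert.hyps by (simp add: P_def poly_sum poly_monom mult_ac)
      with insert.prems(3) show ?thesis by simp
    qed
    then have "P = 0" using poly_all_0_iff_0 by blast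
    then have "coeff P (t w) = 0" by simp
    then show ?thesis
      using insert.prems(1) by (simp add: P_def coeff_sum T'_def sum.inter_filter)
  qed
  moreover have "finite T'" "t \<in> T'" using insert.prems by (auto simp: T'_def)
  ultimately show ?case by (intro insert.IH[of T'])
qed

lemma multipoly_nonzero_somewhere:
  assumes "finite E" "multipoly_vars f \<subseteq> E" "f \<noteq> 0"
  obtains p where "p \<in> E \<rightarrow>\<^sub>E UNIV" "multipoly_eval f p \<noteq> 0"
proof -
  have keys: "Poly_Mapping.keys t \<subseteq> E" if "t \<in> Poly_Mapping.keys f" for t
    using that assms(2) by (auto simp: multipoly_vars_def)
  have eval: "multipoly_eval f p = (\<Sum>t\<in>Poly_Mapping.keys f. Poly_Mapping.lookup f t * (\<Prod>v\<in>E. p v ^ Poly_Mapping.lookup t v))" for p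
    unfolding multipoly_eval_superset[OF finite_keys subset_refl]
    by (intro sum.cong refl arg_cong2[of _ _ _ _ "(*)"] monomial_fun_superset assms(1) keys)
  have inj: "inj_on Poly_Mapping.lookup T" for T :: "('a \<Rightarrow>\<^sub>0 nat) set"
    by (simp add: inj_on_def lookup_inject)
  obtain t where t: "t \<in> Poly_Mapping.keys f" using assms(3) by (metis all_not_in_conv keys_eq_empty)
  have "\<exists>p. multipoly_eval f p \<noteq> 0"
  proof (rule ccontr)
    assume "\<not> ?thesis"
    then have z: "multipoly_eval f p = 0" for p by simp
    let ?T = "Poly_Mapping.lookup ` Poly_Mapping.keys f"
    \<comment> \<open>Exponents are passed to plain functions through \<open>lookup\<close>;
      \<open>Abs_poly_mapping\<close> leads back.\<close>
    have "Poly_Mapping.lookup f (Abs_poly_mapping (Poly_Mapping.lookup t)) = 0"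
    proof (rule monomial_sum_zero_imp_coeffs_zero[OF assms(1), of ?T "\<lambda>s. Poly_Mapping.lookup f (Abs_poly_mapping s)"])
      show "inj_on (\<lambda>t. restrict t E) ?T"
      proof (rule inj_onI, clarsimp)
        fix s u assume su: "s \<in> Poly_Mapping.keys f" "u \<in> Poly_Mapping.keys f"
          and e: "restrict (Poly_Mapping.lookup s) E = restrict (Poly_Mapping.lookup u) E"
        show "s = u"
        proof (rule poly_mapping_eqI)
          fix v show "Poly_Mapping.lookup s v = Poly_Mapping.lookup u v"
          proof (cases "v \<in> E")
            case True then show ?thesis using fun_cong[OF e, of v] by simp
          next
            case False
            then show ?thesis using keys su by (metis in_keys_iff subsetD)
          qed
        qed
      qed
      show "(\<Sum>t\<in>?T. Poly_Mapping.lookup f (Abs_poly_mapping t) * (\<Prod>v\<in>E. p v ^ t v)) = 0" for p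
        using z[of p] unfolding eval by (simp add: sum.reindex[OF inj] lookup_inverse)
    qed (use t in auto)
    with t show False by (simp add: lookup_inverse in_keys_iff)
  qed
  then obtain p where p: "multipoly_eval f p \<noteq> 0" by blast
  \<comment> \<open>Only values on \<open>E\<close> enter, so the point can be cut down to one of
    the parameter space.\<close>
  have "multipoly_eval f (restrict p E) = multipoly_eval f p"
    unfolding eval by simp
  with p show ?thesis by (intro that[of "restrict p E"]) auto
qed

section \<open>Accessible states\<close>

text \<open>An entry at \<open>(i, Inl j)\<close> lets state \<open>j\<close> act on state
  \<open>i\<close>, so walks run from column to row. The index counts the states before
  \<open>i\<close> on the walk.\<close>

inductive access :: "('n \<times> ('n + 'm)) set \<Rightarrow> nat \<Rightarrow> 'n \<Rightarrow> bool" for E where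
  input: "(i, Inr k) \<in> E \<Longrightarrow> access E 0 i"
| state: "(i, Inl j) \<in> E \<Longrightarrow> access E n j \<Longrightarrow> access E (Suc n) i"

text \<open>A spanning forest directed away from the inputs: \<open>pa i\<close> is the column from which state \<open>i\<close> is
  entered and \<open>dep i\<close> the number of states before \<open>i\<close> on its branch.\<close>

definition branching :: "('n \<Rightarrow> 'n + 'm) \<Rightarrow> ('n \<Rightarrow> nat) \<Rightarrow> bool" where
  "branching pa dep \<longleftrightarrow> (\<forall>i. case pa i of Inl j \<Rightarrow> dep i = Suc (dep j) | Inr k \<Rightarrow> dep i = 0)"

text \<open>\<open>dep\<close> is the distance from the inputs; the predecessor on a shortest walk
  is exactly one step closer.\<close>

lemma branching_exists:
  fixes E :: "('n \<times> ('n + 'm)) set"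
  assumes "\<And>i. \<exists>n. access E n i"
  obtains pa dep where "branching pa dep" "\<And>i. (i, pa i) \<in> E"
proof -
  define dep where "dep i = (LEAST n. access E n i)" for i
  have a: "access E (dep i) i" for i unfolding dep_def using assms by (rule LeastI_ex)
  have le: "dep i \<le> n" if "access E n i" for i n unfolding dep_def using that by (rule Least_le)
  have "\<exists>c. (i, c) \<in> E \<and> (case c of Inl j \<Rightarrow> dep i = Suc (dep j) | Inr k \<Rightarrow> dep i = 0)" for i
    using a[of i]
  proof cases
    case (input k)
    then show ?thesis by (intro exI[of _ "Inr k"]) simp
  next
    case (state j n)
    have "dep i \<le> Suc (dep j)" using state(2) a by (intro le access.state)
    moreover have "dep j \<le> n" using state(3) by (rule le)
    ultimately show ?thesis using state by (intro exI[of _ "Inl j"]) simp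
  qed
  then have "\<exists>pa. \<forall>i. (i, pa i) \<in> E \<and> (case pa i of Inl j \<Rightarrow> dep i = Suc (dep j) | Inr k \<Rightarrow> dep i = 0)"
    by (intro choice) blast
  then show ?thesis using that by (auto simp: branching_def)
qed

text \<open>Pairs go from parent to child: in the reflexive transitive closure the first state is an
  ancestor of the second or equal to it.\<close>

definition child_rel :: "('n \<Rightarrow> 'n + 'm) \<Rightarrow> ('n \<times> 'n) set" where
  "child_rel pa = {(j, i). pa i = Inl j}"

lemma dep_child_rel:
  assumes "branching pa dep" "(j, i) \<in> (child_rel pa)\<^sup>*"
  shows "j = i \<or> dep j < dep i"
  using assms(2)
proof (induction rule: rtrancl_induct)
  case (step a b)
  have "dep b = Suc (dep a)"
    using assms(1) step.hyps(2) by (auto simp: branching_def child_rel_def dest: spec[of _ b])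
  with step.IH show ?case by auto
qed simp

text \<open>Ancestors of one state lie on a single branch and are comparable, while states entered
  from the same column have equal depth.\<close>

lemma branching_siblings_eq:
  assumes br: "branching pa dep" and "pa c = pa c'"
    and "(c, i) \<in> (child_rel pa)\<^sup>*" "(c', i) \<in> (child_rel pa)\<^sup>*"
  shows "c = c'"
proof -
  have "dep c = dep c'"
    using spec[OF br[unfolded branching_def], of c] spec[OF br[unfolded branching_def], of c'] assms(2)
    by (auto split: sum.splits)
  moreover have "single_valued ((child_rel pa)\<inverse>)" by (auto simp: single_valued_def child_rel_def)
  then have "(c, c') \<in> ((child_rel pa)\<inverse>)\<^sup>* \<or> (c', c) \<in> ((child_rel pa)\<inverse>)\<^sup>*"
    by (rule single_valued_confluent) (use assms in \<open>auto simp: rtrancl_converse\<close>)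
  then have "(c', c) \<in> (child_rel pa)\<^sup>* \<or> (c, c') \<in> (child_rel pa)\<^sup>*"
    by (simp add: rtrancl_converse)
  ultimately show ?thesis using dep_child_rel[OF br] by fastforce
qed

section \<open>Redundant edges\<close>

text \<open>The graph of an injective choice of columns is a saturating matching.\<close>

lemma nonredundant_part_graph_of_inj:
  fixes \<phi> :: "'r::finite \<Rightarrow> 'c::finite"
  assumes "inj \<phi>" "\<And>r. (r, \<phi> r) \<in> E"
  shows "(r, \<phi> r) \<in> nonredundant_part E"
proof -
  let ?F = "range (\<lambda>r. (r, \<phi> r))"
  have "matching E ?F" using assms by (auto simp: matching_def dest: injD)
  moreover have "row_saturating ?F" unfolding row_saturating_def by (rule card_image) (auto simp: inj_on_def)
  ultimately show ?thesis using assms(2) by (auto simp: nonredundant_part_def redundant_def)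
qed

lemma row_saturating_matching_covers:
  fixes F :: "('r::finite \<times> 'c::finite) set"
  assumes "matching E F" "row_saturating F"
  shows "\<exists>c. (r, c) \<in> F"
proof -
  have "inj_on fst F" using assms(1) by (auto simp: inj_on_def matching_def)
  then have "card (fst ` F) = CARD('r)" using assms(2) by (simp add: card_image row_saturating_def)
  then have "fst ` F = UNIV" by (intro card_subset_eq) auto
  then show ?thesis by (metis UNIV_I imageE prod.collapse)
qed

text \<open>The equality case of Hall's condition: a saturating matching sends \<open>S\<close>
  injectively into \<open>T\<close>, hence onto it, so each column of \<open>T\<close> is matched to
  a row of \<open>S\<close>.\<close>

lemma nonredundant_tight_rows:
  fixes E :: "('r::finite \<times> 'c::finite) set"
  assumes edge: "(r, c) \<in> nonredundant_part E" and c: "c \<in> T"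
    and nb: "\<And>r c. (r, c) \<in> E \<Longrightarrow> r \<in> S \<Longrightarrow> c \<in> T" and card: "card T \<le> card S"
  shows "r \<in> S"
proof -
  from edge obtain F where F: "matching E F" "row_saturating F" "(r, c) \<in> F"
    by (auto simp: nonredundant_part_def redundant_def)
  then obtain \<phi> where \<phi>: "\<And>r. (r, \<phi> r) \<in> F" using row_saturating_matching_covers by metis
  have m: "(r, c) \<in> E" "r = r'" if "(r, c) \<in> F" "(r', c) \<in> F" for r r' c
    using F(1) that unfolding matching_def by blast+
  have "inj_on \<phi> S" using \<phi> m by (metis inj_onI)
  then have "card (\<phi> ` S) = card S" by (rule card_image)
  moreover have "\<phi> ` S \<subseteq> T" using \<phi> m nb by blast
  ultimately have "\<phi> ` S = T" using card by (intro card_seteq) auto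
  with c obtain s where "s \<in> S" "c = \<phi> s" by auto
  with \<phi> m F(3) show ?thesis by metis
qed

lemma same_component_invariant:
  assumes "same_component E v w" "v \<in> X"
    and "\<And>r c. (r, c) \<in> E \<Longrightarrow> Inl r \<in> X \<longleftrightarrow> Inr c \<in> X"
  shows "w \<in> X"
  using assms(1)[unfolded same_component_def]
proof (induction rule: rtrancl_induct)
  case (step y z)
  then show ?case using assms(3) by (auto simp: adjacency_def)
qed (rule assms(2))

text \<open>The rows of inaccessible states meet only the columns of these states, equally many. By
  tightness these rows and columns are closed under nonredundant edges, and no input is among
  them.\<close>

lemma connected_imp_accessible:
  fixes E :: "('n::finite \<times> ('n + 'm::finite)) set"
  assumes "same_component (nonredundant_part E) (state_vertex i) (input_vertex j)"
  shows "\<exists>n. access E n i"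
proof (rule ccontr)
  assume i: "\<not> ?thesis"
  define S where "S = {i. \<not> (\<exists>n. access E n i)}"
  have nb: "c \<in> Inl ` S" if "(r, c) \<in> E" "r \<in> S" for r c
    using that by (cases c) (auto simp: S_def intro: access.intros)
  have "(input_vertex j :: 'n + ('n + 'm)) \<in> Inl ` S \<union> Inr ` Inl ` S"
  proof (rule same_component_invariant[OF assms])
    show "state_vertex i \<in> Inl ` S \<union> Inr ` Inl ` S" using i by (auto simp: S_def)
    fix r c assume e: "(r, c) \<in> nonredundant_part E"
    then have "(r, c) \<in> E" by (simp add: nonredundant_part_def)
    moreover have "r \<in> S" if "c \<in> Inl ` S"
      by (rule nonredundant_tight_rows[OF e that nb]) (auto simp: card_image)
    ultimately show "Inl r \<in> Inl ` S \<union> Inr ` Inl ` S \<longleftrightarrow> Inr c \<in> Inl ` S \<union> Inr ` Inl ` S"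
      using nb by auto
  qed
  then show False by auto
qed

lemma branching_edge_nonredundant:
  fixes E :: "('n::finite \<times> ('n + 'm::finite)) set"
  assumes diag: "\<And>i. (i, Inl i) \<in> E" and br: "branching pa dep" and pa: "\<And>i. (i, pa i) \<in> E"
  shows "(i, pa i) \<in> nonredundant_part E"
proof -
  define \<phi> where "\<phi> t = (if (t, i) \<in> (child_rel pa)\<^sup>* then pa t else Inl t)" for t
  have anc: "(t', i) \<in> (child_rel pa)\<^sup>*" if "pa t = Inl t'" "(t, i) \<in> (child_rel pa)\<^sup>*" for t t'
    using that by (auto simp: child_rel_def intro: converse_rtrancl_into_rtrancl)
  have "inj \<phi>"
  proof (rule injI)
    fix t t' assume "\<phi> t = \<phi> t'"
    then show "t = t'"
      using branching_siblings_eq[OF br] anc by (auto simp: \<phi>_def split: if_splits)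
  qed
  moreover have "(t, \<phi> t) \<in> E" for t using diag pa by (simp add: \<phi>_def)
  ultimately have "(i, \<phi> i) \<in> nonredundant_part E" by (rule nonredundant_part_graph_of_inj)
  then show ?thesis by (simp add: \<phi>_def)
qed

text \<open>A diagonal edge followed by a forest edge leads from the column of \<open>i\<close> to
  \<open>pa i\<close>; repeating this climbs to an input.\<close>

lemma accessible_imp_connected:
  fixes E :: "('n::finite \<times> ('n + 'm::finite)) set"
  assumes diag: "\<And>i. (i, Inl i) \<in> E" and acc: "\<And>i. \<exists>n. access E n i"
  shows "\<exists>j. same_component (nonredundant_part E) (state_vertex i) (input_vertex j)"
proof -
  obtain pa dep where br: "branching pa dep" and pa: "\<And>i. (i, pa i) \<in> E"
    using branching_exists[OF acc] by blast
  have "inj (Inl :: 'n \<Rightarrow> 'n + 'm)" by simp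
  then have "(i, Inl i) \<in> nonredundant_part E" for i
    by (rule nonredundant_part_graph_of_inj) (rule diag)
  then have "(state_vertex i, Inl i) \<in> adjacency (nonredundant_part E)" for i
    by (auto simp: adjacency_def)
  moreover have "(Inl i, Inr (pa i)) \<in> adjacency (nonredundant_part E)" for i
    using branching_edge_nonredundant[OF diag br pa] by (auto simp: adjacency_def)
  ultimately have step: "(state_vertex i, Inr (pa i)) \<in> (adjacency (nonredundant_part E))\<^sup>*" for i
    by (meson r_into_rtrancl rtrancl.rtrancl_into_rtrancl)
  show ?thesis
  proof (induction "dep i" arbitrary: i rule: less_induct)
    case less
    show ?case
    proof (cases "pa i")
      case (Inr k)
      with step[of i] show ?thesis by (auto simp: same_component_def)
    next
      case (Inl l)
      then have "dep l < dep i"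
        using spec[OF br[unfolded branching_def], of i] by simp
      from less[OF this] step[of i] Inl show ?thesis
        by (auto simp: same_component_def intro: rtrancl_trans)
    qed
  qed
qed

section \<open>Generic controllability\<close>

lemma polynomial_fun_krylov:
  fixes E :: "('n::finite \<times> ('n + 'm::finite)) set"
  shows "polynomial_fun E (\<lambda>p. krylov (param_A E p) (param_B E p) k j $ i)"
proof (induction k arbitrary: i)
  case 0
  show ?case
    by (cases "(i, Inr j) \<in> E")
      (simp_all add: krylov_0 param_B_def polynomial_fun_var polynomial_fun_const)
next
  case (Suc k)
  have "polynomial_fun E (\<lambda>p. param_A E p $ i $ l)" for l
    by (cases "(i, Inl l) \<in> E")
      (simp_all add: param_A_def polynomial_fun_var polynomial_fun_const)
  then show ?case
    unfolding krylov_Suc matrix_vector_mult_def vec_lambda_beta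
    by (intro polynomial_fun_sum polynomial_fun_mult Suc.IH)
qed

text \<open>Row vectors supported on the inaccessible states form a nonzero invariant space that
  annihilates \<open>B\<close>, whatever the parameters.\<close>

lemma inaccessible_imp_not_controllable:
  fixes E :: "('n::finite \<times> ('n + 'm::finite)) set"
  assumes "\<nexists>n. access E n i"
  shows "\<not> controllable (param_A E p) (param_B E p)"
proof -
  define S where "S = {i. \<nexists>n. access E n i}"
  have nb: "(r, Inl j) \<notin> E" if "r \<in> S" "j \<notin> S" for r j
    using that by (auto simp: S_def intro: access.intros)
  have nb': "(r, Inr k) \<notin> E" if "r \<in> S" for r k
    using that by (auto simp: S_def intro: access.intros)
  define V where "V = {v :: complex ^ 'n. \<forall>r. r \<notin> S \<longrightarrow> v $ r = 0}"
  have "vec.subspace V" by (auto simp: V_def vec.subspace_def)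
  moreover have "axis i 1 \<in> V" "axis i 1 \<noteq> (0 :: complex ^ 'n)"
    using assms by (auto simp: V_def S_def axis_def vec_eq_iff)
  moreover have "v v* map_matrix complex_of_real (param_A E p) \<in> V" if "v \<in> V" for v
  proof -
    have "v $ r * of_real (param_A E p $ r $ j) = 0" if "j \<notin> S" for r j
      using \<open>v \<in> V\<close> nb that by (cases "r \<in> S") (auto simp: V_def param_A_def)
    then show ?thesis
      unfolding V_def vector_matrix_mult_def map_matrix_def by (auto intro!: sum.neutral)
  qed
  ultimately obtain l v where v: "v \<in> V" "v \<noteq> 0"
      "v v* map_matrix complex_of_real (param_A E p) = l *s v"
    by (rule invariant_subspace_eigenvector)
  have "v $ r * of_real (param_B E p $ r $ j) = 0" for r j
    using v(1) nb' by (cases "r \<in> S") (auto simp: V_def param_B_def)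
  then have "v v* map_matrix complex_of_real (param_B E p) = 0"
    unfolding vec_eq_iff vector_matrix_mult_def map_matrix_def by (auto intro!: sum.neutral)
  with v show ?thesis by (auto simp: controllable_iff_left_eigenvector)
qed

text \<open>Below each state in the support of a bad left eigenvector lies one whose diagonal entry
  is \<open>l\<close>. Distinct entries make it the same state for all, so the support lies on one
  branch; its top coordinate is then forced to vanish.\<close>

lemma branching_controllable:
  fixes E :: "('n::finite \<times> ('n + 'm::finite)) set"
  assumes diag: "\<And>i. (i, Inl i) \<in> E" and br: "branching pa dep" and pa: "\<And>i. (i, pa i) \<in> E"
    and d: "inj d"
    and p: "p = (\<lambda>(i, c). if c = Inl i then d i else if pa i = c then 1 else 0)"
  shows "controllable (param_A E p) (param_B E p)"
  unfolding controllable_iff_left_eigenvector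
proof (intro allI impI, rule ccontr)
  fix l and v :: "complex ^ 'n"
  assume vA: "v v* map_matrix complex_of_real (param_A E p) = l *s v"
    and vB: "v v* map_matrix complex_of_real (param_B E p) = 0" and v0: "v \<noteq> 0"
  have br': "dep i = Suc (dep j)" if "pa i = Inl j" for i j
    using spec[OF br[unfolded branching_def], of i] that by simp
  have colA: "v $ t * d t + (\<Sum>i | pa i = Inl t. v $ i) = l * v $ t" for t
  proof -
    \<comment> \<open>The two summands never overlap: a diagonal forest edge would make
      \<open>dep\<close> exceed itself.\<close>
    have "v $ i * of_real (param_A E p $ i $ t)
        = (if i = t then v $ i * d i else 0) + (if pa i = Inl t then v $ i else 0)" for i
      using diag pa[of i] br'[of i t] by (auto simp: param_A_def p)
    moreover have "(\<Sum>i\<in>UNIV. v $ i * of_real (param_A E p $ i $ t)) = l * v $ t"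
      using vec_eq_iff[THEN iffD1, OF vA] by (simp add: vector_matrix_mult_def map_matrix_def)
    ultimately show ?thesis by (simp add: sum.distrib sum.If_cases)
  qed
  have colB: "(\<Sum>i | pa i = Inr k. v $ i) = 0" for k
  proof -
    have "v $ i * of_real (param_B E p $ i $ k) = (if pa i = Inr k then v $ i else 0)" for i
      using pa[of i] by (auto simp: param_B_def p)
    moreover have "(\<Sum>i\<in>UNIV. v $ i * of_real (param_B E p $ i $ k)) = 0"
      using vec_eq_iff[THEN iffD1, OF vB] by (simp add: vector_matrix_mult_def map_matrix_def)
    ultimately show ?thesis by (simp add: sum.If_cases)
  qed
  have desc: "\<exists>t. (j, t) \<in> (child_rel pa)\<^sup>* \<and> d t = l" if "v $ j \<noteq> 0" for j
  proof -
    \<comment> \<open>A deepest support state \<open>t\<close> below \<open>j\<close> has no child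
      in the support, so its column equation reduces to \<open>d t = l\<close>.\<close>
    define D where "D = {t. (j, t) \<in> (child_rel pa)\<^sup>* \<and> v $ t \<noteq> 0}"
    have "D \<noteq> {}" using that by (auto simp: D_def)
    then have "Max (dep ` D) \<in> dep ` D" by (intro Max_in) auto
    then obtain t where "Max (dep ` D) = dep t" and t: "t \<in> D" by (rule imageE)
    then have max: "dep s \<le> dep t" if "s \<in> D" for s
      using Max_ge[of "dep ` D" "dep s"] that by simp
    have "v $ s = 0" if "pa s = Inl t" for s
    proof (rule ccontr)
      assume "v $ s \<noteq> 0"
      moreover have "(j, s) \<in> (child_rel pa)\<^sup>*"
        using t that by (auto simp: D_def child_rel_def intro: rtrancl_into_rtrancl)
      ultimately have "dep s \<le> dep t" by (intro max) (simp add: D_def)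
      with br'[OF that] show False by simp
    qed
    then have "v $ t * d t = l * v $ t" using colA[of t] by simp
    with t show ?thesis by (auto simp: D_def mult.commute)
  qed
  have uniq: "c = c'" if c: "v $ c \<noteq> 0" "v $ c' \<noteq> 0" and sib: "pa c = pa c'" for c c'
  proof -
    obtain t t' where "(c, t) \<in> (child_rel pa)\<^sup>*" "d t = l" "(c', t') \<in> (child_rel pa)\<^sup>*" "d t' = l"
      using desc[OF c(1)] desc[OF c(2)] by blast
    moreover from this have "t = t'" using d by (metis injD of_real_eq_iff)
    ultimately show ?thesis using branching_siblings_eq[OF br sib] by blast
  qed
  obtain j where j: "v $ j \<noteq> 0" and min: "\<And>s. v $ s \<noteq> 0 \<Longrightarrow> dep j \<le> dep s"
    using v0 ex_has_least_nat[of "\<lambda>j. v $ j \<noteq> 0" _ dep] by (auto simp: vec_eq_iff)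
  \<comment> \<open>Only \<open>j\<close> itself contributes among its siblings, yet the column of
    the parent makes the sum zero: a parent state lies above the support, and an input column has no
    diagonal term.\<close>
  have "(\<Sum>c | pa c = pa j. v $ c) = (\<Sum>c | pa c = pa j. if c = j then v $ j else 0)"
    using uniq[OF _ j] by (intro sum.cong) auto
  also have "\<dots> = v $ j" by simp
  also have "(\<Sum>c | pa c = pa j. v $ c) = 0"
  proof (cases "pa j")
    case (Inl t)
    have "v $ t = 0" using min[of t] br'[OF Inl] by auto
    then show ?thesis using colA[of t] Inl by simp
  next
    case (Inr k)
    then show ?thesis using colB[of k] by simp
  qed
  finally show False using j by simp
qed

text \<open>A nonzero polynomial is nonzero at some parameter point, so genericity supplies one
  controllable system. Conversely, one controllable system supplies a Krylov determinant that is not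
  the zero polynomial.\<close>

lemma generically_controllable_iff_accessible:
  fixes E :: "('n::finite \<times> ('n + 'm::finite)) set"
  assumes diag: "\<And>i. (i, Inl i) \<in> E"
  shows "(\<exists>f :: ('n \<times> ('n + 'm)) multipoly. f \<noteq> 0 \<and> multipoly_vars f \<subseteq> E \<and>
        {p \<in> E \<rightarrow>\<^sub>E UNIV. \<not> controllable (param_A E p) (param_B E p)}
          \<subseteq> {p \<in> E \<rightarrow>\<^sub>E UNIV. multipoly_eval f p = 0}) \<longleftrightarrow> (\<forall>i. \<exists>n. access E n i)"
    (is "?G \<longleftrightarrow> _")
proof
  assume ?G
  then obtain f :: "('n \<times> ('n + 'm)) multipoly" where f: "f \<noteq> 0" "multipoly_vars f \<subseteq> E"
    and z: "\<And>p. p \<in> E \<rightarrow>\<^sub>E UNIV \<Longrightarrow> \<not> controllable (param_A E p) (param_B E p) \<Longrightarrow> multipoly_eval f p = 0"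
    by blast
  obtain p where "p \<in> E \<rightarrow>\<^sub>E UNIV" "multipoly_eval f p \<noteq> 0"
    using multipoly_nonzero_somewhere[OF finite f(2,1)] by blast
  with z have "controllable (param_A E p) (param_B E p)" by blast
  then show "\<forall>i. \<exists>n. access E n i" using inaccessible_imp_not_controllable by blast
next
  assume acc: "\<forall>i. \<exists>n. access E n i"
  obtain pa dep where br: "branching pa dep" and pa: "\<And>i. (i, pa i) \<in> E"
    using branching_exists[of E] acc by blast
  obtain h :: "'n \<Rightarrow> nat" where "inj h" using finite_imp_inj_to_nat_seg[of "UNIV :: 'n set"] by auto
  then have "inj (\<lambda>i. real (h i))" by (auto simp: inj_def)
  then obtain p0 where "controllable (param_A E p0) (param_B E p0)"
    using branching_controllable[OF diag br pa] by blast
  then obtain k j where det: "det (\<chi> r. krylov (param_A E p0) (param_B E p0) (k r) (j r)) \<noteq> 0"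
    by (rule controllable_imp_krylov_det_neq_0)
  have "polynomial_fun E (\<lambda>p. det (\<chi> r. krylov (param_A E p) (param_B E p) (k r) (j r)))"
    by (intro polynomial_fun_det) (simp add: polynomial_fun_krylov)
  then obtain f where f: "multipoly_vars f \<subseteq> E"
      "\<And>p. multipoly_eval f p = det (\<chi> r. krylov (param_A E p) (param_B E p) (k r) (j r))"
    by (auto simp: polynomial_fun_def)
  \<comment> \<open>\<open>p0\<close> need not be extensional; \<open>f\<close> agrees with the
    determinant at every \<open>p\<close>.\<close>
  have "f \<noteq> 0" using det f(2)[of p0] by (auto simp: multipoly_eval_def)
  with f show ?G by (intro exI[of _ f]) (auto simp: krylov_det_eq_0)
qed

theorem theorem7:
  fixes A :: "real ^ 'n ^ 'n" and B :: "real ^ 'm ^ 'n"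
  defines "G \<equiv> assoc_graph (sys_matrix A B)"
  defines "G\<^sub>n\<^sub>r \<equiv> nonredundant_part G"
  shows "generically_controllable A B \<longleftrightarrow>
    (\<forall>i. \<exists>j. same_component G\<^sub>n\<^sub>r (state_vertex i) (input_vertex j))"
proof -
  \<comment> \<open>A diagonal entry has degree one in the indeterminate, whatever the value in
    \<open>A\<close>.\<close>
  have diag: "(i, Inl i) \<in> G" for i
    by (simp add: G_def assoc_graph_def sys_matrix_def hcat_def mat_def map_matrix_def)
  have "generically_controllable A B \<longleftrightarrow> (\<forall>i. \<exists>n. access G n i)"
    unfolding generically_controllable_def Let_def G_def[symmetric]
    by (rule generically_controllable_iff_accessible) (rule diag)
  also have "\<dots> \<longleftrightarrow> (\<forall>i. \<exists>j. same_component G\<^sub>n\<^sub>r (state_vertex i) (input_vertex j))"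
    unfolding G\<^sub>n\<^sub>r_def using connected_imp_accessible accessible_imp_connected[of G] diag by blast
  finally show ?thesis .
qed

end
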